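(* There is an algorithm that, given an instance $(G=(V,E,w),A,X)$ of Effectors-Cost and a node $v\in V$, computes the probability $p(v|X)$ in $O(2^r\cdot n(n+m))$ time, where $n=|V|$, $m=|E|$ and $r=|\{u\to v\in E: w(u\to v)<1\}|$ is the number of probabilistic arcs. Accordingly, Effectors-Cost can be solved in $O(2^r\cdot n^2(n+m))$ time.
   Context: An influence graph $G=(V,E,w)$ is a finite simple directed graph (no loops) with a weight function $w:E\to(0,1]\cap\mathbb{Q}$. Independent Cascade process started from $X\subseteq V$: at time $0$ exactly the nodes in $X$ are active. When a node $u$ becomes active for the first time, at time step $t$, it gets a single chance to activate each currently inactive out-neighbor $v$, succeeding with probability $w(u\to v)$, all attempts being independent; if it succeeds, $v$ becomes active at step $t+1$; if it fails, $u$ makes no further attempts on $v$. Active nodes stay active. The process terminates when there are no newly activated nodes. Let $p(v|X)$ be the probability that $v$ is active upon termination. Cost: for $A\subseteq V$ and $X\subseteq V$, $C_A(G,X):=\sum_{v\in A}(1-p(v|X))+\sum_{v\in V\setminus A}p(v|X)$. Effectors-Cost: given an influence graph $G=(V,E,w)$, a set of target nodes $A\subseteq V$, and a set of effectors $X\subseteq V$, compute $C_A(G,X)$. Running-time convention: the precision of the probabilities given by $w$ is polynomially bounded in $n$, and additions and multiplications of rational numbers are assumed to take constant time. *)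

theory Defs
  imports "Graph_Theory.Pair_Digraph" "HOL-Probability.Probability"
begin

section \<open>Influence graphs and the Independent Cascade process\<close>

locale influence_graph = pair_digraph G for G :: "'a pair_pre_digraph" +
  fixes w :: "'a \<times> 'a \<Rightarrow> rat"
  assumes weight_pos: "e \<in> parcs G \<Longrightarrow> 0 < w e"
    and weight_le_1: "e \<in> parcs G \<Longrightarrow> w e \<le> 1"

text \<open>\<open>Act\<close> is the set of all currently active nodes, \<open>New \<subseteq> Act\<close> the set of those
  that have become active in the current time step.\<close>

definition attempts :: "'a pair_pre_digraph \<Rightarrow> 'a set \<Rightarrow> 'a set \<Rightarrow> ('a \<times> 'a) set" where
  "attempts G Act New = {(u, v) \<in> parcs G. u \<in> New \<and> v \<notin> Act}"

definition newly_activated ::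
  "'a pair_pre_digraph \<Rightarrow> ('a \<times> 'a \<Rightarrow> rat) \<Rightarrow> 'a set \<Rightarrow> 'a set \<Rightarrow> 'a set pmf" where
  "newly_activated G w Act New =
     map_pmf (\<lambda>succeeds. {v. \<exists>u. (u, v) \<in> attempts G Act New \<and> succeeds (u, v)})
       (Pi_pmf (attempts G Act New) False (\<lambda>e. bernoulli_pmf (of_rat (w e))))"

text \<open>The distribution of the set of active nodes upon termination.\<close>

partial_function (spmf) cascade ::
  "'a pair_pre_digraph \<Rightarrow> ('a \<times> 'a \<Rightarrow> rat) \<Rightarrow> 'a set \<Rightarrow> 'a set \<Rightarrow> 'a set spmf" where
  "cascade G w Act New =
     (if New = {} then return_spmf Act
      else bind_spmf (spmf_of_pmf (newly_activated G w Act New))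
             (\<lambda>New'. cascade G w (Act \<union> New') New'))"

definition activation_prob ::
  "'a pair_pre_digraph \<Rightarrow> ('a \<times> 'a \<Rightarrow> rat) \<Rightarrow> 'a set \<Rightarrow> 'a \<Rightarrow> real" where
  "activation_prob G w X v = measure (measure_spmf (cascade G w X X)) {S. v \<in> S}"

definition effectors_cost ::
  "'a pair_pre_digraph \<Rightarrow> ('a \<times> 'a \<Rightarrow> rat) \<Rightarrow> 'a set \<Rightarrow> 'a set \<Rightarrow> real" where
  "effectors_cost G w A X =
     (\<Sum>v\<in>A. 1 - activation_prob G w X v) + (\<Sum>v\<in>pverts G - A. activation_prob G w X v)"

definition probabilistic_arcs :: "'a pair_pre_digraph \<Rightarrow> ('a \<times> 'a \<Rightarrow> rat) \<Rightarrow> ('a \<times> 'a) set" where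
  "probabilistic_arcs G w = {e \<in> parcs G. w e < 1}"

text \<open>Sanity check: the process terminates almost surely.\<close>

lemma set_newly_activated:
  assumes "S \<in> set_pmf (newly_activated G w Act New)"
  shows "S \<subseteq> snd ` parcs G - Act"
  using assms by (force simp: newly_activated_def attempts_def)

lemma lossless_cascade:
  assumes "finite (parcs G)"
  shows "lossless_spmf (cascade G w Act New)"
proof (induction "card (snd ` parcs G - Act)" arbitrary: Act New rule: less_induct)
  case less
  have fin: "finite (snd ` parcs G)" using assms by simp
  have rec: "lossless_spmf (cascade G w (Act \<union> S) S)"
    if S: "S \<in> set_pmf (newly_activated G w Act New)" for S
  proof (cases "S = {}")
    case True
    then show ?thesis by (subst cascade.simps) simp
  next
    case False
    have "snd ` parcs G - (Act \<union> S) \<subset> snd ` parcs G - Act"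
      using set_newly_activated[OF S] False by blast
    then show ?thesis
      using fin by (intro less.hyps psubset_card_mono) auto
  qed
  show ?case
    by (subst cascade.simps) (use rec in auto)
qed


section \<open>A random access machine with unit-cost rational arithmetic\<close>

text \<open>Programs work on finitely many arrays of natural numbers and finitely many arrays of
  rational numbers, both named by natural numbers; a scalar variable is cell \<open>0\<close> of an array.
  Every operator, constant, memory access and command step costs one time unit. To keep the
  unit-cost convention harmless, natural numbers can only be added and subtracted,
  rational numbers can only be added, subtracted, multiplied and tested for equality, and
  there is no conversion between the two sorts.\<close>

datatype nexp =
    NConst nat
  | NGet nat nexp
  | NPlus nexp nexp
  | NMinus nexp nexp

datatype qexp =
    QConst rat
  | QGet nat nexp
  | QPlus qexp qexp
  | QMinus qexp qexp
  | QTimes qexp qexp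

datatype bexp =
    NLess nexp nexp
  | QEq qexp qexp
  | BNot bexp
  | BAnd bexp bexp

datatype com =
    Skip
  | NSet nat nexp nexp
  | QSet nat nexp qexp
  | Seq com com
  | Cond bexp com com
  | While bexp com

record memory =
  nmem :: "nat \<Rightarrow> nat \<Rightarrow> nat"
  qmem :: "nat \<Rightarrow> nat \<Rightarrow> rat"

fun nval :: "nexp \<Rightarrow> memory \<Rightarrow> nat" where
  "nval (NConst k) s = k"
| "nval (NGet a i) s = nmem s a (nval i s)"
| "nval (NPlus e f) s = nval e s + nval f s"
| "nval (NMinus e f) s = nval e s - nval f s"

fun qval :: "qexp \<Rightarrow> memory \<Rightarrow> rat" where
  "qval (QConst q) s = q"
| "qval (QGet a i) s = qmem s a (nval i s)"
| "qval (QPlus e f) s = qval e s + qval f s"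
| "qval (QMinus e f) s = qval e s - qval f s"
| "qval (QTimes e f) s = qval e s * qval f s"

fun bval :: "bexp \<Rightarrow> memory \<Rightarrow> bool" where
  "bval (NLess e f) s \<longleftrightarrow> nval e s < nval f s"
| "bval (QEq e f) s \<longleftrightarrow> qval e s = qval f s"
| "bval (BNot b) s \<longleftrightarrow> \<not> bval b s"
| "bval (BAnd b c) s \<longleftrightarrow> bval b s \<and> bval c s"

fun ncost :: "nexp \<Rightarrow> nat" where
  "ncost (NConst k) = 1"
| "ncost (NGet a i) = 1 + ncost i"
| "ncost (NPlus e f) = 1 + ncost e + ncost f"
| "ncost (NMinus e f) = 1 + ncost e + ncost f"

fun qcost :: "qexp \<Rightarrow> nat" where
  "qcost (QConst q) = 1"
| "qcost (QGet a i) = 1 + ncost i"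
| "qcost (QPlus e f) = 1 + qcost e + qcost f"
| "qcost (QMinus e f) = 1 + qcost e + qcost f"
| "qcost (QTimes e f) = 1 + qcost e + qcost f"

fun bcost :: "bexp \<Rightarrow> nat" where
  "bcost (NLess e f) = 1 + ncost e + ncost f"
| "bcost (QEq e f) = 1 + qcost e + qcost f"
| "bcost (BNot b) = 1 + bcost b"
| "bcost (BAnd b c) = 1 + bcost b + bcost c"

definition nupdate :: "nat \<Rightarrow> nat \<Rightarrow> nat \<Rightarrow> memory \<Rightarrow> memory" where
  "nupdate a i x s = s\<lparr>nmem := (nmem s)(a := (nmem s a)(i := x))\<rparr>"

definition qupdate :: "nat \<Rightarrow> nat \<Rightarrow> rat \<Rightarrow> memory \<Rightarrow> memory" where
  "qupdate a i x s = s\<lparr>qmem := (qmem s)(a := (qmem s a)(i := x))\<rparr>"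

text \<open>\<open>exec c s t s'\<close>: started in memory \<open>s\<close>, program \<open>c\<close> halts after exactly \<open>t\<close> time units
  in memory \<open>s'\<close>.\<close>

inductive exec :: "com \<Rightarrow> memory \<Rightarrow> nat \<Rightarrow> memory \<Rightarrow> bool" where
  Skip: "exec Skip s 1 s"
| NSet: "exec (NSet a i e) s (1 + ncost i + ncost e) (nupdate a (nval i s) (nval e s) s)"
| QSet: "exec (QSet a i e) s (1 + ncost i + qcost e) (qupdate a (nval i s) (qval e s) s)"
| Seq: "exec c s t s' \<Longrightarrow> exec d s' t' s'' \<Longrightarrow> exec (Seq c d) s (1 + t + t') s''"
| CondTrue: "bval b s \<Longrightarrow> exec c s t s' \<Longrightarrow> exec (Cond b c d) s (1 + bcost b + t) s'"
| CondFalse: "\<not> bval b s \<Longrightarrow> exec d s t s' \<Longrightarrow> exec (Cond b c d) s (1 + bcost b + t) s'"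
| WhileFalse: "\<not> bval b s \<Longrightarrow> exec (While b c) s (1 + bcost b) s"
| WhileTrue: "bval b s \<Longrightarrow> exec c s t s' \<Longrightarrow> exec (While b c) s' t' s'' \<Longrightarrow>
    exec (While b c) s (1 + bcost b + t + t') s''"

inductive_cases exec_SkipE: "exec Skip s t s'"
  and exec_NSetE: "exec (NSet a i e) s t s'"
  and exec_QSetE: "exec (QSet a i e) s t s'"
  and exec_SeqE: "exec (Seq c d) s t s'"
  and exec_CondE: "exec (Cond b c d) s t s'"
  and exec_WhileE: "exec (While b c) s t s'"

lemma exec_deterministic:
  assumes "exec c s t s'" and "exec c s t2 s2"
  shows "t2 = t \<and> s2 = s'"
  using assms
proof (induction arbitrary: t2 s2 rule: exec.induct)
  case (Skip s)
  then show ?case by (rule exec_SkipE) simp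
next
  case (NSet a i e s)
  then show ?case by (rule exec_NSetE) simp
next
  case (QSet a i e s)
  then show ?case by (rule exec_QSetE) simp
next
  case (Seq c s t s' d t' s'')
  from Seq.prems obtain t1 s1 t1' where *:
    "exec c s t1 s1" "exec d s1 t1' s2" "t2 = 1 + t1 + t1'"
    by (rule exec_SeqE) simp
  have "t1 = t \<and> s1 = s'" by (rule Seq.IH(1)[OF *(1)])
  with * Seq.IH(2)[of t1' s2] show ?case by simp
next
  case (CondTrue b s c t s' d)
  from CondTrue.prems CondTrue.hyps obtain t1 where *: "exec c s t1 s2" "t2 = 1 + bcost b + t1"
    by (elim exec_CondE) simp_all
  with CondTrue.IH[OF *(1)] show ?case by simp
next
  case (CondFalse b s d t s' c)
  from CondFalse.prems CondFalse.hyps obtain t1 where *: "exec d s t1 s2" "t2 = 1 + bcost b + t1"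
    by (elim exec_CondE) simp_all
  with CondFalse.IH[OF *(1)] show ?case by simp
next
  case (WhileFalse b s c)
  from WhileFalse.prems show ?case
    by (rule exec_WhileE) (use WhileFalse.hyps in simp_all)
next
  case (WhileTrue b s c t s' t' s'')
  from WhileTrue.prems obtain t1 s1 t1' where *:
    "exec c s t1 s1" "exec (While b c) s1 t1' s2" "t2 = 1 + bcost b + t1 + t1'"
    by (rule exec_WhileE) (use WhileTrue.hyps(1) in simp_all)
  have "t1 = t \<and> s1 = s'" by (rule WhileTrue.IH(1)[OF *(1)])
  with * WhileTrue.IH(2)[of t1' s2] show ?case by simp
qed


section \<open>Instances, their encoding, and the output\<close>

text \<open>Nodes are numbered \<open>0, \<dots>, n - 1\<close>, and the arcs are listed in an arbitrary order \<open>es\<close>.\<close>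

definition effectors_instance ::
  "nat pair_pre_digraph \<Rightarrow> (nat \<times> nat \<Rightarrow> rat) \<Rightarrow> (nat \<times> nat) list \<Rightarrow> nat set \<Rightarrow> nat set \<Rightarrow> bool" where
  "effectors_instance G w es A X \<longleftrightarrow>
     influence_graph G w \<and> pverts G = {..<card (pverts G)} \<and>
     distinct es \<and> set es = parcs G \<and> A \<subseteq> pverts G \<and> X \<subseteq> pverts G"

text \<open>Natural-number arrays: \<open>0\<close> holds \<open>n\<close> and \<open>m\<close> in cells \<open>0\<close> and \<open>1\<close>; \<open>1\<close> and \<open>2\<close> hold the tails
  and heads of the listed arcs; \<open>3\<close> and \<open>4\<close> are the characteristic vectors of \<open>A\<close> and \<open>X\<close>.
  Rational array \<open>0\<close> holds the weights of the listed arcs. All other cells are \<open>0\<close>.\<close>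

definition encode_instance ::
  "nat pair_pre_digraph \<Rightarrow> (nat \<times> nat \<Rightarrow> rat) \<Rightarrow> (nat \<times> nat) list \<Rightarrow> nat set \<Rightarrow> nat set \<Rightarrow> memory" where
  "encode_instance G w es A X =
     \<lparr>nmem = (\<lambda>a i.
        if a = 0 then (if i = 0 then card (pverts G) else if i = 1 then length es else 0)
        else if a = 1 then (if i < length es then fst (es ! i) else 0)
        else if a = 2 then (if i < length es then snd (es ! i) else 0)
        else if a = 3 then (if i \<in> A then 1 else 0)
        else if a = 4 then (if i \<in> X then 1 else 0)
        else 0),
      qmem = (\<lambda>a i. if a = 0 \<and> i < length es then w (es ! i) else 0)\<rparr>"

text \<open>A queried node is stored in cell \<open>2\<close> of natural-number array \<open>0\<close>.\<close>

definition encode_query ::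
  "nat pair_pre_digraph \<Rightarrow> (nat \<times> nat \<Rightarrow> rat) \<Rightarrow> (nat \<times> nat) list \<Rightarrow> nat set \<Rightarrow> nat set \<Rightarrow> nat \<Rightarrow> memory"
  where "encode_query G w es A X v = nupdate 0 2 v (encode_instance G w es A X)"

definition result :: "memory \<Rightarrow> rat" where
  "result s = qmem s 1 0"

end

theory Submission
  imports Defs
begin

text \<open>Since every arc is attempted at most once, the coins of all arcs can be flipped before the
  cascade starts, and the final active set is the set of nodes reachable from the effectors along
  the arcs whose coin shows success. Only the probabilistic arcs have a random coin, so the
  activation probabilities and the cost are weighted sums over \<open>2 ^ r\<close> outcomes. For each outcome,
  \<open>n\<close> scans of the arc list compute the reachable nodes in time \<open>O(n (n + m))\<close>, because every scan
  that does not reach closure adds a node. The cost needs only one such sweep, as all nodes are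
  scored at once.\<close>

section \<open>Flipping all coins in advance\<close>

text \<open>The cascade draws fresh coins in every round, so agreement with one advance draw has to
  be proved for an arbitrary intermediate state, the unseen coins being a separate set. On the
  machine, naturals are only added and subtracted and do not convert to rationals: world counts
  arise by doubling, and the probability of a world is accumulated while its number is decoded
  against a table of counts. Rationals are only tested for equality, so an arc counts as
  probabilistic when its weight differs from \<open>1\<close>. Query and cost differ only in the
  score given to the active set of a world, hence one program with the score as a parameter. Time
  bounds are rounded up generously; a score of cost \<open>D * (n + 1)\<close> leads to the factor
  \<open>500 + 2 * D\<close>, which is \<open>530\<close> for the query (\<open>D = 15\<close>) and
  \<open>640\<close> for the cost (\<open>D = 70\<close>).\<close>

definition spread :: "('a \<times> 'a) set \<Rightarrow> 'a set \<Rightarrow> 'a set \<Rightarrow> ('a \<times> 'a \<Rightarrow> bool) \<Rightarrow> 'a set" where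
  "spread E Act New F = Act \<union> {(u, v) \<in> E. F (u, v) \<and> v \<notin> Act}\<^sup>* `` New"

text \<open>This is one round of the process. Arcs into \<open>Act\<close> are dropped in
  \<open>spread\<close>, so that no path passes through an old node that has used up its chances.
  Every remaining arc out of \<open>New\<close> lies in \<open>T\<close>, so a path enters
  \<open>New'\<close> by a coin of \<open>f\<close> and moves on by coins of \<open>g\<close>; a
  later visit to \<open>New'\<close> restarts it there.\<close>

lemma spread_step:
  assumes "New \<subseteq> Act"
    and T: "T = {(u, v) \<in> E. u \<in> New \<and> v \<notin> Act}"
    and New': "New' = {v. \<exists>u. (u, v) \<in> T \<and> f (u, v)}"
  shows "spread E Act New (\<lambda>e. if e \<in> T then f e else g e) = spread E (Act \<union> New') New' g"
proof -
  define R where "R = {(u, v) \<in> E. (if (u, v) \<in> T then f (u, v) else g (u, v)) \<and> v \<notin> Act}"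
  define R' where "R' = {(u, v) \<in> E. g (u, v) \<and> v \<notin> Act \<union> New'}"
  have "x \<in> New \<or> x \<in> R'\<^sup>* `` New'" if "(a, x) \<in> R\<^sup>*" "a \<in> New" for a x
    using that
  proof (induction rule: rtrancl_induct)
    case base
    then show ?case by simp
  next
    case (step y z)
    show ?case
    proof (cases "(y, z) \<in> T")
      case True
      then show ?thesis using step.hyps New' by (auto simp: R_def)
    next
      case False
      then have "y \<notin> New" using step.hyps by (auto simp: R_def T)
      with step have y: "y \<in> R'\<^sup>* `` New'" by blast
      show ?thesis
      proof (cases "z \<in> New'")
        case False
        then have "(y, z) \<in> R'" using step.hyps \<open>(y, z) \<notin> T\<close> by (auto simp: R_def R'_def)
        then show ?thesis using y by (blast intro: rtrancl_into_rtrancl)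
      qed blast
    qed
  qed
  \<comment> \<open>A path from \<open>New'\<close> stays outside \<open>Act\<close>, so it never
    leaves a node of \<open>New\<close>: its arcs are not in \<open>T\<close>, and both sides read
    their coins from \<open>g\<close>.\<close>
  moreover have "x \<notin> Act \<and> x \<in> R\<^sup>* `` New" if "(a, x) \<in> R'\<^sup>*" "a \<in> New'" for a x
    using that
  proof (induction rule: rtrancl_induct)
    case base
    then obtain u where "(u, a) \<in> T" "f (u, a)" unfolding New' by blast
    then have "u \<in> New" "(u, a) \<in> R" "a \<notin> Act" by (auto simp: T R_def)
    then show ?case by blast
  next
    case (step y z)
    then have "(y, z) \<in> R" using \<open>New \<subseteq> Act\<close> by (auto simp: R_def R'_def T)
    then show ?case using step by (auto simp: R'_def intro: rtrancl_into_rtrancl)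
  qed
  ultimately show ?thesis
    using \<open>New \<subseteq> Act\<close> unfolding spread_def R_def[symmetric] R'_def[symmetric] by blast
qed

text \<open>A path from \<open>X\<close> that returns to \<open>X\<close> can be cut at its last
  visit, so dropping the arcs into \<open>X\<close> loses no node.\<close>

lemma spread_start:
  "spread E X X F = {(u, v) \<in> E. F (u, v)}\<^sup>* `` X"
proof -
  define R where "R = {(u, v) \<in> E. F (u, v) \<and> v \<notin> X}"
  define R' where "R' = {(u, v) \<in> E. F (u, v)}"
  have "x \<in> R\<^sup>* `` X" if "(a, x) \<in> R'\<^sup>*" "a \<in> X" for a x
    using that
  proof (induction rule: rtrancl_induct)
    case (step y z)
    then show ?case
      by (cases "z \<in> X") (auto simp: R_def R'_def intro: rtrancl_into_rtrancl)
  qed auto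
  moreover have "R\<^sup>* \<subseteq> R'\<^sup>*" by (rule rtrancl_mono) (auto simp: R_def R'_def)
  ultimately show ?thesis unfolding spread_def R_def[symmetric] R'_def[symmetric] by blast
qed

text \<open>\<open>D\<close> collects the arcs whose coin has not been looked at yet.\<close>

lemma cascade_eq_spread:
  assumes "finite (parcs G)" "New \<subseteq> Act" "D \<subseteq> parcs G"
    and "{(u, v) \<in> parcs G. (u \<in> New \<or> u \<notin> Act) \<and> v \<notin> Act} \<subseteq> D"
  shows "cascade G w Act New =
    spmf_of_pmf (map_pmf (spread (parcs G) Act New)
      (Pi_pmf D False (\<lambda>e. bernoulli_pmf (of_rat (w e)))))"
  using assms(2-)
proof (induction "card (snd ` parcs G - Act)" arbitrary: Act New D rule: less_induct)
  case less
  let ?p = "\<lambda>e. bernoulli_pmf (of_rat (w e))"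
  let ?T = "attempts G Act New"
  show ?case
  proof (cases "New = {}")
    case True
    then have "spread (parcs G) Act New = (\<lambda>_. Act)" by (simp add: spread_def fun_eq_iff)
    then show ?thesis using True by (subst cascade.simps) (simp add: map_pmf_const)
  next
    case False
    define new where "new f = {v. \<exists>u. (u, v) \<in> ?T \<and> f (u, v)}" for f
    have T: "?T \<subseteq> D" using less.prems by (auto simp: attempts_def)
    have fin: "finite D" using less.prems assms(1) finite_subset by blast
    \<comment> \<open>Deferred decisions: the coins of this round and those of later rounds are
      independent, so the advance draw factors into two.\<close>
    have split: "Pi_pmf D False ?p = map_pmf (\<lambda>(f, g) e. if e \<in> ?T then f e else g e)
        (pair_pmf (Pi_pmf ?T False ?p) (Pi_pmf (D - ?T) False ?p))"
      using Pi_pmf_union[of ?T "D - ?T" False ?p] T fin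
      by (auto simp: Un_absorb1 dest: finite_subset)
    have step: "spread (parcs G) Act New (\<lambda>e. if e \<in> ?T then f e else g e)
        = spread (parcs G) (Act \<union> new f) (new f) g" for f g
      by (rule spread_step) (use less.prems in \<open>auto simp: new_def attempts_def\<close>)
    \<comment> \<open>If no node is activated, the measure does not drop, but then both sides are
      constantly \<open>Act\<close>.\<close>
    have rec: "cascade G w (Act \<union> new f) (new f) =
        spmf_of_pmf (map_pmf (spread (parcs G) (Act \<union> new f) (new f)) (Pi_pmf (D - ?T) False ?p))"
      (is "_ = ?rhs") for f
    proof (cases "new f = {}")
      case True
      then have "spread (parcs G) (Act \<union> new f) (new f) = (\<lambda>_. Act)"
        by (simp add: spread_def fun_eq_iff)
      then show ?thesis using True by (subst cascade.simps) (simp add: map_pmf_const)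
    next
      case False
      have "new f \<subseteq> snd ` parcs G - Act" by (force simp: new_def attempts_def)
      then have "snd ` parcs G - (Act \<union> new f) \<subset> snd ` parcs G - Act" using False by blast
      \<comment> \<open>Both kinds of tail lie outside \<open>Act\<close>, hence outside
        \<open>New\<close>, so none of these arcs is attempted in the current round.\<close>
      moreover have "{(u, v) \<in> parcs G. (u \<in> new f \<or> u \<notin> Act \<union> new f) \<and> v \<notin> Act \<union> new f} \<subseteq> D - ?T"
      proof -
        have "new f \<inter> Act = {}" by (auto simp: new_def attempts_def)
        then show ?thesis using less.prems by (fastforce simp: attempts_def)
      qed
      ultimately show ?thesis
        using assms(1) less.prems by (intro less.hyps psubset_card_mono) auto
    qed
    have "cascade G w Act New = bind_spmf (spmf_of_pmf (newly_activated G w Act New))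
             (\<lambda>New'. cascade G w (Act \<union> New') New')"
      using False by (subst cascade.simps) simp
    also have "\<dots> = bind_pmf (Pi_pmf ?T False ?p)
        (\<lambda>f. cascade G w (Act \<union> new f) (new f))"
      by (simp add: newly_activated_def new_def[abs_def] bind_map_pmf)
    also have "\<dots> = spmf_of_pmf (map_pmf (spread (parcs G) Act New) (Pi_pmf D False ?p))"
      unfolding split rec
      by (simp add: step spmf_of_pmf_def pair_pmf_def map_pmf_def bind_assoc_pmf bind_return_pmf)
    finally show ?thesis .
  qed
qed

text \<open>A world fixes the outcomes of all probabilistic arcs. Worlds are numbered in such a way that
  they can be decoded by comparisons and subtractions only; the head of the list is the most
  significant digit, and arcs of weight \<open>1\<close> carry no digit.\<close>

fun worlds :: "('a \<Rightarrow> rat) \<Rightarrow> 'a list \<Rightarrow> nat" where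
  "worlds w [] = 1"
| "worlds w (e # es) = (if w e = 1 then worlds w es else worlds w es + worlds w es)"

fun world :: "('a \<Rightarrow> rat) \<Rightarrow> 'a list \<Rightarrow> nat \<Rightarrow> 'a \<Rightarrow> bool" where
  "world w [] k = (\<lambda>_. False)"
| "world w (e # es) k =
     (if w e = 1 then (world w es k)(e := True)
      else if k < worlds w es then (world w es k)(e := False)
      else (world w es (k - worlds w es))(e := True))"

fun world_prob :: "('a \<Rightarrow> rat) \<Rightarrow> 'a list \<Rightarrow> nat \<Rightarrow> rat" where
  "world_prob w [] k = 1"
| "world_prob w (e # es) k =
     (if w e = 1 then world_prob w es k
      else if k < worlds w es then (1 - w e) * world_prob w es k
      else w e * world_prob w es (k - worlds w es))"

lemma worlds_eq_power: "worlds w es = 2 ^ length (filter (\<lambda>e. w e \<noteq> 1) es)"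
  by (induction es) simp_all

lemma sum_lessThan_double:
  fixes f :: "nat \<Rightarrow> 'b::comm_monoid_add"
  shows "sum f {..<n + n} = sum f {..<n} + (\<Sum>k<n. f (k + n))"
  using sum.atLeastLessThan_concat[of 0 n "n + n" f]
    sum.shift_bounds_nat_ivl[of f 0 n n] by (simp add: atLeast0LessThan)

text \<open>Condition on the coin of the head of the list: the induction hypothesis is needed for
  \<open>h\<close> with that coin fixed to either value, which is why \<open>h\<close> is
  arbitrary.\<close>

lemma expectation_worlds:
  fixes h :: "('a \<Rightarrow> bool) \<Rightarrow> real"
  assumes "distinct es" "\<And>e. e \<in> set es \<Longrightarrow> 0 \<le> w e \<and> w e \<le> 1"
  shows "measure_pmf.expectation (Pi_pmf (set es) False (\<lambda>e. bernoulli_pmf (of_rat (w e)))) h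
    = (\<Sum>k<worlds w es. of_rat (world_prob w es k) * h (world w es k))"
  using assms
proof (induction es arbitrary: h)
  case Nil
  then show ?case by simp
next
  case (Cons e es)
  let ?p = "\<lambda>e. bernoulli_pmf (real_of_rat (w e))"
  let ?E = "\<lambda>h. \<Sum>k<worlds w es. of_rat (world_prob w es k) * h (world w es k)"
  have p: "0 \<le> real_of_rat (w e)" "real_of_rat (w e) \<le> 1"
    using Cons.prems by (auto simp: of_rat_le_1_iff)
  have fin: "finite (set_pmf (Pi_pmf (set es) False ?p))"
    by (rule finite_subset[OF set_Pi_pmf_subset']) (auto intro!: finite_PiE_dflt)
  have "measure_pmf.expectation (Pi_pmf (set (e # es)) False ?p) h
      = measure_pmf.expectation (?p e) (\<lambda>y.
          measure_pmf.expectation (Pi_pmf (set es) False ?p) (\<lambda>f. h (f(e := y))))"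
  proof -
    have "Pi_pmf (set (e # es)) False ?p =
        bind_pmf (?p e) (\<lambda>y. map_pmf (\<lambda>f. f(e := y)) (Pi_pmf (set es) False ?p))"
      using Cons.prems by (simp add: Pi_pmf_insert' map_pmf_def)
    then show ?thesis
      using fin by (simp add: pmf_expectation_bind[where A = UNIV] integral_measure_pmf[where A = UNIV])
  qed
  also have "\<dots> = ?E (\<lambda>f. h (f(e := True))) * of_rat (w e) + ?E (\<lambda>f. h (f(e := False))) * (1 - of_rat (w e))"
    using Cons.IH Cons.prems p by simp
  \<comment> \<open>The two summands fill the two halves of the index range; for a head of weight
    \<open>1\<close> the \<open>False\<close> summand vanishes and no doubling takes place.\<close>
  also have "\<dots> = (\<Sum>k<worlds w (e # es). of_rat (world_prob w (e # es) k) * h (world w (e # es) k))"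
    by (auto simp: sum_lessThan_double sum_distrib_right sum_distrib_left of_rat_mult of_rat_diff
        algebra_simps)
  finally show ?case .
qed


section \<open>Activation probability and cost as sums over worlds\<close>

definition reach :: "('a \<times> 'a) set \<Rightarrow> 'a set \<Rightarrow> ('a \<times> 'a \<Rightarrow> bool) \<Rightarrow> 'a set" where
  "reach E X F = {(u, v) \<in> E. F (u, v)}\<^sup>* `` X"

context influence_graph
begin

lemma activation_prob_worlds:
  assumes "distinct es" "set es = parcs G"
  shows "activation_prob G w X v =
    (\<Sum>k<worlds w es. of_rat (world_prob w es k) * of_bool (v \<in> reach (parcs G) X (world w es k)))"
proof -
  let ?p = "Pi_pmf (parcs G) False (\<lambda>e. bernoulli_pmf (of_rat (w e)))"
  have "cascade G w X X = spmf_of_pmf (map_pmf (reach (parcs G) X) ?p)"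
  proof -
    have "spread (parcs G) X X = reach (parcs G) X"
      by (simp add: fun_eq_iff spread_start reach_def)
    \<comment> \<open>Before the first round no coin has been looked at, so \<open>D\<close>
      consists of all arcs.\<close>
    then show ?thesis by (subst cascade_eq_spread[where D = "parcs G"]) auto
  qed
  then have "activation_prob G w X v = measure_pmf.expectation ?p
      (indicator {F. v \<in> reach (parcs G) X F})"
    by (simp add: activation_prob_def vimage_def)
  also have "\<dots> = (\<Sum>k<worlds w es. of_rat (world_prob w es k)
      * of_bool (v \<in> reach (parcs G) X (world w es k)))"
    using expectation_worlds[of es w "indicator {F. v \<in> reach (parcs G) X F}"] assms
      weight_pos weight_le_1
    by (auto simp: indicator_def less_imp_le intro!: sum.cong)
  finally show ?thesis .
qed

lemma sum_world_prob:
  assumes "distinct es" "set es = parcs G"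
  shows "(\<Sum>k<worlds w es. real_of_rat (world_prob w es k)) = 1"
  using expectation_worlds[of es w "\<lambda>_. 1"] assms weight_pos weight_le_1
  by (auto simp: less_imp_le)

text \<open>As the world probabilities sum to \<open>1\<close>, each
  \<open>1 - activation_prob G w X v\<close> is itself a sum over the worlds that miss
  \<open>v\<close>; exchanging the sums leaves one score per world.\<close>

lemma effectors_cost_worlds:
  assumes "distinct es" "set es = parcs G"
  shows "effectors_cost G w A X =
    (\<Sum>k<worlds w es. of_rat (world_prob w es k) *
      ((\<Sum>v\<in>A. of_bool (v \<notin> reach (parcs G) X (world w es k))) +
       (\<Sum>v\<in>pverts G - A. of_bool (v \<in> reach (parcs G) X (world w es k)))))"
proof -
  have "1 - activation_prob G w X v =
    (\<Sum>k<worlds w es. of_rat (world_prob w es k) * of_bool (v \<notin> reach (parcs G) X (world w es k)))"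
    for v
    unfolding activation_prob_worlds[OF assms] sum_world_prob[OF assms, symmetric]
    by (simp only: sum_subtractf[symmetric]) (rule sum.cong, auto)
  then show ?thesis
    unfolding effectors_cost_def
    by (simp only: activation_prob_worlds[OF assms, abs_def] distrib_left sum.distrib sum_distrib_left
        sum.swap[of _ "{..<worlds w es}"])
qed

end


section \<open>Running time of programs\<close>

text \<open>A total-correctness triple in which \<open>T\<close> only bounds the time from above, so
  that constants may be rounded up.\<close>

definition runs :: "com \<Rightarrow> memory \<Rightarrow> nat \<Rightarrow> (memory \<Rightarrow> bool) \<Rightarrow> bool" where
  "runs c s T Q \<longleftrightarrow> (\<exists>t s'. exec c s t s' \<and> t \<le> T \<and> Q s')"

primrec nwrites :: "com \<Rightarrow> nat set" where
  "nwrites Skip = {}"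
| "nwrites (NSet a i e) = {a}"
| "nwrites (QSet a i e) = {}"
| "nwrites (Seq c d) = nwrites c \<union> nwrites d"
| "nwrites (Cond b c d) = nwrites c \<union> nwrites d"
| "nwrites (While b c) = nwrites c"

primrec qwrites :: "com \<Rightarrow> nat set" where
  "qwrites Skip = {}"
| "qwrites (NSet a i e) = {}"
| "qwrites (QSet a i e) = {a}"
| "qwrites (Seq c d) = qwrites c \<union> qwrites d"
| "qwrites (Cond b c d) = qwrites c \<union> qwrites d"
| "qwrites (While b c) = qwrites c"

lemma nmem_nupdate [simp]: "nmem (nupdate a i x s) b = (if b = a then (nmem s a)(i := x) else nmem s b)"
  and qmem_nupdate [simp]: "qmem (nupdate a i x s) = qmem s"
  and qmem_qupdate [simp]: "qmem (qupdate a i y s) b = (if b = a then (qmem s a)(i := y) else qmem s b)"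
  and nmem_qupdate [simp]: "nmem (qupdate a i y s) = nmem s"
  by (simp_all add: nupdate_def qupdate_def)

lemma exec_frame:
  assumes "exec c s t s'"
  shows "(\<forall>a. a \<notin> nwrites c \<longrightarrow> nmem s' a = nmem s a) \<and> (\<forall>a. a \<notin> qwrites c \<longrightarrow> qmem s' a = qmem s a)"
  using assms by induction auto

text \<open>Specifications can thus state only what a program computes; what it leaves intact
  follows from the arrays that occur as targets in its text.\<close>

lemma runs_frame:
  assumes "runs c s T Q"
  shows "runs c s T (\<lambda>s'. Q s' \<and> (\<forall>a. a \<notin> nwrites c \<longrightarrow> nmem s' a = nmem s a)
    \<and> (\<forall>a. a \<notin> qwrites c \<longrightarrow> qmem s' a = qmem s a))"
  using assms unfolding runs_def by (meson exec_frame)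

lemma runs_weaken:
  assumes "runs c s T Q" "T \<le> T'" "\<And>s'. Q s' \<Longrightarrow> Q' s'"
  shows "runs c s T' Q'"
  using assms unfolding runs_def by (meson order_trans)

lemma runs_Seq:
  assumes "runs c s T P" "\<And>s'. P s' \<Longrightarrow> runs d s' T' Q"
  shows "runs (Seq c d) s (1 + T + T') Q"
proof -
  obtain t s' where c: "exec c s t s'" "t \<le> T" "P s'"
    using assms(1) by (auto simp: runs_def)
  moreover obtain t' s'' where d: "exec d s' t' s''" "t' \<le> T'" "Q s''"
    using assms(2)[OF c(3)] by (auto simp: runs_def)
  ultimately show ?thesis
    using exec.Seq[OF c(1) d(1)] unfolding runs_def
    by (intro exI[of _ "1 + t + t'"] exI[of _ s'']) simp
qed

section \<open>Straight-line code\<close>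

primrec loop_free :: "com \<Rightarrow> bool" where
  "loop_free Skip \<longleftrightarrow> True"
| "loop_free (NSet a i e) \<longleftrightarrow> True"
| "loop_free (QSet a i e) \<longleftrightarrow> True"
| "loop_free (Seq c d) \<longleftrightarrow> loop_free c \<and> loop_free d"
| "loop_free (Cond b c d) \<longleftrightarrow> loop_free c \<and> loop_free d"
| "loop_free (While b c) \<longleftrightarrow> False"

primrec effect :: "com \<Rightarrow> memory \<Rightarrow> memory" where
  "effect Skip s = s"
| "effect (NSet a i e) s = nupdate a (nval i s) (nval e s) s"
| "effect (QSet a i e) s = qupdate a (nval i s) (qval e s) s"
| "effect (Seq c d) s = effect d (effect c s)"
| "effect (Cond b c d) s = (if bval b s then effect c s else effect d s)"
| "effect (While b c) s = s"

primrec max_time :: "com \<Rightarrow> nat" where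
  "max_time Skip = 1"
| "max_time (NSet a i e) = 1 + ncost i + ncost e"
| "max_time (QSet a i e) = 1 + ncost i + qcost e"
| "max_time (Seq c d) = 1 + max_time c + max_time d"
| "max_time (Cond b c d) = 1 + bcost b + max (max_time c) (max_time d)"
| "max_time (While b c) = 0"

text \<open>The final memory of loop-free code is a function of the initial one, so such blocks are
  verified by evaluating \<open>effect\<close>, while the time is read off the syntax with the
  slower branch.\<close>

lemma runs_loop_free: "loop_free c \<Longrightarrow> runs c s (max_time c) (\<lambda>s'. s' = effect c s)"
proof (induction c arbitrary: s)
  case (Seq c d)
  then have "runs (Seq c d) s (1 + max_time c + max_time d) (\<lambda>s'. s' = effect d (effect c s))"
    by (intro runs_Seq[where P = "\<lambda>s'. s' = effect c s"]) auto
  then show ?case by simp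
next
  case (Cond b c d)
  obtain t where "exec c s t (effect c s)" "t \<le> max_time c"
    using Cond by (auto simp: runs_def)
  moreover obtain t' where "exec d s t' (effect d s)" "t' \<le> max_time d"
    using Cond by (auto simp: runs_def)
  ultimately show ?case
    using exec.CondTrue[of b s c t "effect c s" d] exec.CondFalse[of b s d t' "effect d s" c]
    by (cases "bval b s") (fastforce simp: runs_def)+
qed (fastforce simp: runs_def intro: exec.Skip exec.NSet exec.QSet)+

section \<open>Counting loops\<close>

definition For :: "nat \<Rightarrow> nexp \<Rightarrow> com \<Rightarrow> com" where
  "For x b c = Seq (NSet x (NConst 0) (NConst 0))
     (While (NLess (NGet x (NConst 0)) b)
       (Seq c (NSet x (NConst 0) (NPlus (NGet x (NConst 0)) (NConst 1)))))"

lemma nwrites_For [simp]: "nwrites (For x b c) = insert x (nwrites c)"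
  and qwrites_For [simp]: "qwrites (For x b c) = qwrites c"
  by (auto simp: For_def)

text \<open>By \<open>counter\<close> the invariant survives any change of the loop counter, so the
  increment needs no reasoning of its own; the body gets the counter value as a separate premise.
  The exact overhead is \<open>8 + ncost b\<close> outside the iterations and
  \<open>11 + ncost b\<close> in each; \<open>13\<close> and \<open>16\<close> are rounded
  up.\<close>

lemma runs_For:
  fixes I :: "nat \<Rightarrow> memory \<Rightarrow> bool"
  assumes "x \<notin> nwrites c"
    and init: "I 0 s"
    and bound: "\<And>i s'. I i s' \<Longrightarrow> i \<le> N \<Longrightarrow> nval b s' = N"
    and counter: "\<And>i j s'. I i s' \<Longrightarrow> I i (nupdate x 0 j s')"
    and body: "\<And>i s'. I i s' \<Longrightarrow> i < N \<Longrightarrow> nmem s' x 0 = i \<Longrightarrow> runs c s' T (I (Suc i))"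
  shows "runs (For x b c) s (13 + ncost b + N * (16 + ncost b + T)) (I N)"
proof -
  let ?b = "NLess (NGet x (NConst 0)) b"
  let ?c = "Seq c (NSet x (NConst 0) (NPlus (NGet x (NConst 0)) (NConst 1)))"
  have loop: "runs (While ?b ?c) s' (5 + ncost b + (N - i) * (16 + ncost b + T)) (I N)"
    if "I i s'" "i \<le> N" "nmem s' x 0 = i" for i s'
    using that
  proof (induction "N - i" arbitrary: i s')
    case 0
    then have "exec (While ?b ?c) s' (1 + bcost ?b) s'"
      using bound by (intro exec.WhileFalse) simp
    then show ?case using 0 unfolding runs_def by (intro exI) auto
  next
    case (Suc k)
    obtain t s1 where c: "exec c s' t s1" "t \<le> T" "I (Suc i) s1"
      using body[OF Suc.prems(1)] Suc unfolding runs_def by force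
    have s1: "nmem s1 x = nmem s' x" using exec_frame[OF c(1)] assms(1) by simp
    let ?s2 = "nupdate x 0 (Suc i) s1"
    have "exec ?c s' (1 + t + 6) ?s2"
      using exec.Seq[OF c(1) exec.NSet[of x "NConst 0" "NPlus (NGet x (NConst 0)) (NConst 1)"]]
        s1 Suc.prems(3) by (simp add: eval_nat_numeral)
    moreover have "runs (While ?b ?c) ?s2 (5 + ncost b + (N - Suc i) * (16 + ncost b + T)) (I N)"
      using Suc.hyps Suc.prems counter[OF c(3)] by (intro Suc.hyps) auto
    then obtain t' s3 where w: "exec (While ?b ?c) ?s2 t' s3" "I N s3"
      "t' \<le> 5 + ncost b + (N - Suc i) * (16 + ncost b + T)"
      unfolding runs_def by blast
    moreover have "bval ?b s'" using bound Suc by simp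
    ultimately have "exec (While ?b ?c) s' (1 + bcost ?b + (1 + t + 6) + t') s3"
      by (intro exec.WhileTrue)
    moreover have "N - i = Suc (N - Suc i)" using Suc.hyps by simp
    then have "1 + bcost ?b + (1 + t + 6) + t' \<le> 5 + ncost b + (N - i) * (16 + ncost b + T)"
      using w(3) c(2) by simp
    ultimately show ?case using w(2) unfolding runs_def by blast
  qed
  have "runs (For x b c) s (1 + 3 + (5 + ncost b + N * (16 + ncost b + T))) (I N)"
    unfolding For_def
  proof (rule runs_Seq)
    show "runs (NSet x (NConst 0) (NConst 0)) s 3 (\<lambda>s'. s' = nupdate x 0 0 s)"
      using runs_loop_free[of "NSet x (NConst 0) (NConst 0)" s] by (simp add: eval_nat_numeral)
    show "runs (While ?b ?c) s' (5 + ncost b + N * (16 + ncost b + T)) (I N)"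
      if "s' = nupdate x 0 0 s" for s'
      using loop[of 0 s'] counter[OF init] that by simp
  qed
  then show ?thesis by (rule runs_weaken) auto
qed


section \<open>Averaging over all worlds\<close>

abbreviation var :: "nat \<Rightarrow> nexp" where "var x \<equiv> NGet x (NConst 0)"
abbreviation node_count :: nexp where "node_count \<equiv> NGet 0 (NConst 0)"
abbreviation arc_count :: nexp where "arc_count \<equiv> NGet 0 (NConst 1)"
abbreviation nonzero :: "nexp \<Rightarrow> bexp" where "nonzero e \<equiv> NLess (NConst 0) e"

text \<open>Scratch arrays of natural numbers: \<open>5\<close> maps \<open>i\<close> to the number of worlds of the first \<open>i\<close> arcs,
  \<open>6\<close> and \<open>7\<close> are the characteristic vectors of the live arcs and of the active nodes,
  \<open>8\<close> holds the number of the current world and \<open>9\<close> its part that is still to be decoded;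
  \<open>10\<close>, \<open>11\<close> and \<open>12\<close> are loop counters and indices. Scratch arrays of rational numbers: \<open>1\<close>
  accumulates the result, \<open>2\<close> is the probability of the current world and \<open>3\<close> its score. The arcs
  are decoded from the last one to the first one.\<close>

definition tabulate_worlds :: com where
  "tabulate_worlds =
     Seq (NSet 5 (NConst 0) (NConst 1))
       (For 10 arc_count
         (Cond (QEq (QGet 0 (var 10)) (QConst 1))
           (NSet 5 (NPlus (var 10) (NConst 1)) (NGet 5 (var 10)))
           (NSet 5 (NPlus (var 10) (NConst 1)) (NPlus (NGet 5 (var 10)) (NGet 5 (var 10))))))"

text \<open>Entry \<open>i\<close> of the table counts the worlds of the arcs before arc
  \<open>i\<close>, so the last arc carries the most significant digit. Loop counters only run
  upwards, hence the mirrored index in array \<open>12\<close>.\<close>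

definition decode_arc :: com where
  "decode_arc =
     Seq (NSet 12 (NConst 0) (NMinus (NMinus arc_count (NConst 1)) (var 10)))
       (Cond (QEq (QGet 0 (var 12)) (QConst 1))
         (NSet 6 (var 12) (NConst 1))
         (Cond (NLess (var 9) (NGet 5 (var 12)))
           (Seq (NSet 6 (var 12) (NConst 0))
             (QSet 2 (NConst 0)
               (QTimes (QGet 2 (NConst 0)) (QMinus (QConst 1) (QGet 0 (var 12))))))
           (Seq (NSet 6 (var 12) (NConst 1))
             (Seq (NSet 9 (NConst 0) (NMinus (var 9) (NGet 5 (var 12))))
               (QSet 2 (NConst 0) (QTimes (QGet 2 (NConst 0)) (QGet 0 (var 12))))))))"

definition decode_world :: com where
  "decode_world =
     Seq (Seq (NSet 9 (NConst 0) (var 8)) (QSet 2 (NConst 0) (QConst 1)))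
       (For 10 arc_count decode_arc)"

definition activate_effectors :: com where
  "activate_effectors = For 10 node_count (NSet 7 (var 10) (NGet 4 (var 10)))"

definition scan_arcs :: com where
  "scan_arcs =
     For 10 arc_count
       (Cond (BAnd (nonzero (NGet 6 (var 10))) (nonzero (NGet 7 (NGet 1 (var 10)))))
         (NSet 7 (NGet 2 (var 10)) (NConst 1)) Skip)"

definition close_active :: com where
  "close_active = For 11 node_count scan_arcs"

definition process_world :: "com \<Rightarrow> com" where
  "process_world score =
     Seq decode_world (Seq activate_effectors (Seq close_active (Seq score
       (QSet 1 (NConst 0) (QPlus (QGet 1 (NConst 0))
         (QTimes (QGet 2 (NConst 0)) (QGet 3 (NConst 0))))))))"

definition average_worlds :: "com \<Rightarrow> com" where
  "average_worlds score =
     Seq tabulate_worlds (Seq (QSet 1 (NConst 0) (QConst 0))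
       (For 8 (NGet 5 arc_count) (process_world score)))"

definition query_score :: com where
  "query_score =
     Seq (QSet 3 (NConst 0) (QConst 0))
       (Cond (nonzero (NGet 7 (NGet 0 (NConst 2)))) (QSet 3 (NConst 0) (QConst 1)) Skip)"

text \<open>The two negated conjunctions spell an exclusive or: a node adds \<open>1\<close> when
  being a target and being active disagree, which covers both sums of the cost in one pass.\<close>

definition cost_score :: com where
  "cost_score =
     Seq (QSet 3 (NConst 0) (QConst 0))
       (For 10 node_count
         (Cond (BAnd (BNot (BAnd (nonzero (NGet 3 (var 10))) (nonzero (NGet 7 (var 10)))))
                     (BNot (BAnd (BNot (nonzero (NGet 3 (var 10)))) (BNot (nonzero (NGet 7 (var 10)))))))
           (QSet 3 (NConst 0) (QPlus (QGet 3 (NConst 0)) (QConst 1)))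
           Skip))"

lemma nwrites_programs [simp]:
  "nwrites tabulate_worlds = {5, 10}"
  "nwrites decode_world = {6, 9, 10, 12}"
  "nwrites activate_effectors = {7, 10}"
  "nwrites scan_arcs = {7, 10}"
  "nwrites close_active = {7, 10, 11}"
  "nwrites (process_world score) = {6, 7, 9, 10, 11, 12} \<union> nwrites score"
  "nwrites query_score = {}"
  "nwrites cost_score = {10}"
  by (auto simp: tabulate_worlds_def decode_world_def activate_effectors_def decode_arc_def scan_arcs_def
      close_active_def process_world_def query_score_def cost_score_def)

lemma qwrites_programs [simp]:
  "qwrites tabulate_worlds = {}"
  "qwrites decode_world = {2}"
  "qwrites activate_effectors = {}"
  "qwrites scan_arcs = {}"
  "qwrites close_active = {}"
  "qwrites (process_world score) = {1, 2} \<union> qwrites score"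
  "qwrites query_score = {3}"
  "qwrites cost_score = {3}"
  by (auto simp: tabulate_worlds_def decode_world_def activate_effectors_def decode_arc_def scan_arcs_def
      close_active_def process_world_def query_score_def cost_score_def)

section \<open>Correctness and running time of the programs\<close>

definition active :: "nat \<Rightarrow> memory \<Rightarrow> nat set" where
  "active n s = {v. v < n \<and> 0 < nmem s 7 v}"

text \<open>What the two encodings share. The query node and the targets are left out; they enter
  only through the specification of the score.\<close>

locale network_memory =
  fixes s0 :: memory and n :: nat and es :: "(nat \<times> nat) list" and w :: "nat \<times> nat \<Rightarrow> rat"
    and X :: "nat set"
  assumes nodes: "nmem s0 0 0 = n"
    and arcs: "nmem s0 0 1 = length es"
    and tail: "i < length es \<Longrightarrow> nmem s0 1 i = fst (es ! i)"
    and head: "i < length es \<Longrightarrow> nmem s0 2 i = snd (es ! i)"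
    and weight: "i < length es \<Longrightarrow> qmem s0 0 i = w (es ! i)"
    and effector: "nmem s0 4 i = (if i \<in> X then 1 else 0)"
    and distinct_arcs: "distinct es"
    and arc_nodes: "e \<in> set es \<Longrightarrow> fst e < n \<and> snd e < n"
    and effector_nodes: "X \<subseteq> {..<n}"
begin

definition input :: "memory \<Rightarrow> bool" where
  "input s \<longleftrightarrow> (\<forall>a<5. nmem s a = nmem s0 a) \<and> qmem s 0 = qmem s0 0"

lemma runs_input_frame:
  assumes "runs c s T Q" "input s" "\<forall>a\<in>nwrites c. 5 \<le> a" "0 \<notin> qwrites c"
  shows "runs c s T (\<lambda>s'. Q s' \<and> input s' \<and> (\<forall>a. a \<notin> nwrites c \<longrightarrow> nmem s' a = nmem s a)
    \<and> (\<forall>a. a \<notin> qwrites c \<longrightarrow> qmem s' a = qmem s a))"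
  using runs_frame[OF assms(1)]
proof (rule runs_weaken)
  fix s'
  assume s': "Q s' \<and> (\<forall>a. a \<notin> nwrites c \<longrightarrow> nmem s' a = nmem s a)
    \<and> (\<forall>a. a \<notin> qwrites c \<longrightarrow> qmem s' a = qmem s a)"
  have "a \<notin> nwrites c" if "a < 5" for a using assms(3) that by force
  then show "Q s' \<and> input s' \<and> (\<forall>a. a \<notin> nwrites c \<longrightarrow> nmem s' a = nmem s a)
    \<and> (\<forall>a. a \<notin> qwrites c \<longrightarrow> qmem s' a = qmem s a)"
    using s' assms(2,4) by (simp add: input_def)
qed simp

lemma input_nupdate [simp]: "5 \<le> a \<Longrightarrow> input (nupdate a i x s) \<longleftrightarrow> input s"
  and input_qupdate [simp]: "0 < a \<Longrightarrow> input (qupdate a i y s) \<longleftrightarrow> input s"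
  by (auto simp: input_def)

lemma inputD:
  assumes "input s"
  shows "nmem s 0 = nmem s0 0" "nmem s 1 = nmem s0 1" "nmem s 2 = nmem s0 2"
    "nmem s 3 = nmem s0 3" "nmem s 4 = nmem s0 4" "qmem s 0 = qmem s0 0"
  using assms by (auto simp: input_def)

lemmas input_simps = inputD nodes arcs tail head weight effector
  inputD(2)[unfolded One_nat_def] arcs[unfolded One_nat_def] tail[unfolded One_nat_def]

text \<open>On a reversed prefix the next arc becomes the head, as in the recursion of
  \<open>worlds\<close>. The entry at \<open>length es\<close> is the total number of worlds and
  bounds the outer loop.\<close>

definition tabulated :: "memory \<Rightarrow> bool" where
  "tabulated s \<longleftrightarrow> (\<forall>i\<le>length es. nmem s 5 i = worlds w (rev (take i es)))"

lemma runs_tabulate_worlds: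
  assumes "input s"
  shows "runs tabulate_worlds s (30 + 50 * length es) tabulated"
proof -
  let ?I = "\<lambda>i s. input s \<and> (\<forall>j\<le>i. nmem s 5 j = worlds w (rev (take j es)))"
  let ?body = "Cond (QEq (QGet 0 (var 10)) (QConst 1))
     (NSet 5 (NPlus (var 10) (NConst 1)) (NGet 5 (var 10)))
     (NSet 5 (NPlus (var 10) (NConst 1)) (NPlus (NGet 5 (var 10)) (NGet 5 (var 10))))"
  have "runs tabulate_worlds s (1 + 3 + (13 + 2 + length es * (16 + 2 + 20)))
      (?I (length es))"
    unfolding tabulate_worlds_def
  proof (rule runs_Seq)
    show "runs (NSet 5 (NConst 0) (NConst 1)) s 3 (?I 0)"
      by (rule runs_weaken[OF runs_loop_free]) (use assms in auto)
    show "runs (For 10 arc_count ?body) s' (13 + 2 + length es * (16 + 2 + 20)) (?I (length es))"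
      if "?I 0 s'" for s'
    proof -
      have "runs (For 10 arc_count ?body) s'
          (13 + ncost arc_count + length es * (16 + ncost arc_count + 20)) (?I (length es))"
      proof (rule runs_For)
        fix i s1
        assume I: "?I i s1" "i < length es" "nmem s1 10 0 = i"
        have "rev (take (Suc i) es) = es ! i # rev (take i es)"
          using I by (simp add: take_Suc_conv_app_nth)
        then show "runs ?body s1 20 (?I (Suc i))"
          by (intro runs_weaken[OF runs_loop_free])
            (use I in \<open>auto simp: input_simps le_Suc_eq\<close>)
      qed (use that in \<open>auto simp: input_simps\<close>)
      then show ?thesis by (simp add: eval_nat_numeral)
    qed
  qed
  then show ?thesis by (rule runs_weaken) (auto simp: tabulated_def)
qed

lemma runs_decode_world:
  assumes "input s" "tabulated s"
  shows "runs decode_world s (40 + 100 * length es)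
    (\<lambda>s'. (\<forall>i<length es. 0 < nmem s' 6 i \<longleftrightarrow> world w (rev es) (nmem s 8 0) (es ! i)) \<and>
      qmem s' 2 0 = world_prob w (rev es) (nmem s 8 0))"
proof -
  let ?m = "length es" and ?k = "nmem s 8 0"
  \<comment> \<open>After \<open>j\<close> rounds the last \<open>j\<close> arcs are decoded. What
    remains in array \<open>9\<close> numbers a world of the first \<open>?m - j\<close> arcs that
    agrees with world \<open>?k\<close> on them, and the product collected so far times its
    probability is that of world \<open>?k\<close>.\<close>
  define I where "I j s' \<longleftrightarrow> input s' \<and> tabulated s' \<and>
     qmem s' 2 0 * world_prob w (rev (take (?m - j) es)) (nmem s' 9 0) = world_prob w (rev es) ?k \<and>
     (\<forall>i < ?m - j. world w (rev (take (?m - j) es)) (nmem s' 9 0) (es ! i) \<longleftrightarrow>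
        world w (rev es) ?k (es ! i)) \<and>
     (\<forall>i < ?m. ?m - j \<le> i \<longrightarrow> (0 < nmem s' 6 i \<longleftrightarrow> world w (rev es) ?k (es ! i)))" for j s'
  let ?init = "Seq (NSet 9 (NConst 0) (var 8)) (QSet 2 (NConst 0) (QConst 1))"
  have "runs (Seq ?init (For 10 arc_count decode_arc)) s
      (1 + 10 + (13 + ncost arc_count + ?m * (16 + ncost arc_count + 60))) (I ?m)"
  proof (rule runs_Seq)
    show "runs ?init s 10 (I 0)"
      by (rule runs_weaken[OF runs_loop_free]) (use assms in \<open>auto simp: I_def tabulated_def\<close>)
    show "runs (For 10 arc_count decode_arc) s' (13 + ncost arc_count + ?m * (16 + ncost arc_count + 60))
        (I ?m)" if "I 0 s'" for s'
    proof (rule runs_For)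
      fix j s1
      assume I: "I j s1" and j: "j < ?m" "nmem s1 10 0 = j"
      define i where "i = ?m - Suc j"
      have i: "?m - j = Suc i" "?m - Suc j = i" "i < ?m" using j by (auto simp: i_def)
      have take: "rev (take (Suc i) es) = es ! i # rev (take i es)"
        using i by (simp add: take_Suc_conv_app_nth)
      \<comment> \<open>Worlds are built by function updates; distinctness keeps the coin of
        \<open>es ! i\<close> from overwriting that of an earlier arc.\<close>
      have neq: "es ! i' \<noteq> es ! i" if "i' < i" for i'
        using that i distinct_arcs by (simp add: nth_eq_iff_index_eq)
      define L where "L = rev (take i es)"
      have s1: "input s1" "tabulated s1"
        and prob: "qmem s1 2 0 * world_prob w (es ! i # L) (nmem s1 9 0) = world_prob w (rev es) ?k"
        using I unfolding I_def i(1) take L_def by blast+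
      have left: "world w (es ! i # L) (nmem s1 9 0) (es ! i') \<longleftrightarrow> world w (rev es) ?k (es ! i')"
          if "i' < Suc i" for i'
        using I that unfolding I_def i(1) take L_def by blast
      have passed: "0 < nmem s1 6 i' \<longleftrightarrow> world w (rev es) ?k (es ! i')" if "Suc i \<le> i'" "i' < ?m" for i'
        using I that unfolding I_def i(1) by blast
      have T: "nmem s1 5 i = worlds w L"
        using s1 i by (auto simp: tabulated_def L_def)
      have left_neq: "world w (es ! i # L) (nmem s1 9 0) (es ! i') \<longleftrightarrow>
          (if w (es ! i) = 1 \<or> nmem s1 9 0 < worlds w L then world w L (nmem s1 9 0) (es ! i')
           else world w L (nmem s1 9 0 - worlds w L) (es ! i'))" if "i' < i" for i'
        using neq[OF that] by simp
      let ?s = "nupdate 12 0 i s1"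
      have eff: "effect decode_arc s1 =
        (if w (es ! i) = 1 then nupdate 6 i 1 ?s
         else if nmem s1 9 0 < worlds w L then
           qupdate 2 0 (qmem s1 2 0 * (1 - w (es ! i))) (nupdate 6 i 0 ?s)
         else qupdate 2 0 (qmem s1 2 0 * w (es ! i))
           (nupdate 9 0 (nmem s1 9 0 - worlds w L) (nupdate 6 i 1 ?s)))"
        using s1 i j by (simp add: decode_arc_def input_simps T)
      have "I (Suc j) (effect decode_arc s1)"
        unfolding I_def i(2) L_def[symmetric]
      proof (intro conjI allI impI)
        show "input (effect decode_arc s1)" "tabulated (effect decode_arc s1)"
          using s1 by (auto simp: eff tabulated_def)
        show "qmem (effect decode_arc s1) 2 0 * world_prob w L (nmem (effect decode_arc s1) 9 0) =
            world_prob w (rev es) ?k"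
          using prob by (auto simp: eff mult.assoc split: if_splits)
        show "world w L (nmem (effect decode_arc s1) 9 0) (es ! i') \<longleftrightarrow> world w (rev es) ?k (es ! i')"
          if "i' < i" for i'
          using left[of i'] left_neq[OF that] that by (auto simp: eff simp del: world.simps split: if_splits)
        show "0 < nmem (effect decode_arc s1) 6 i' \<longleftrightarrow> world w (rev es) ?k (es ! i')"
          if "i' < ?m" "i \<le> i'" for i'
          using left[of i] passed[of i'] that by (cases "i' = i") (auto simp: eff split: if_splits)
      qed
      then show "runs decode_arc s1 60 (I (Suc j))"
        by (intro runs_weaken[OF runs_loop_free]) (auto simp: decode_arc_def)
    qed (use that in \<open>auto simp: I_def tabulated_def input_simps decode_arc_def\<close>)
  qed
  then show ?thesis
    unfolding decode_world_def
    by (rule runs_weaken) (auto simp: I_def)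
qed

text \<open>Array \<open>7\<close> may still hold the active set of the previous world; copying the
  whole characteristic vector, zeros included, resets it.\<close>

lemma runs_activate_effectors:
  assumes "input s"
  shows "runs activate_effectors s (20 + 40 * n) (\<lambda>s'. active n s' = X)"
proof -
  let ?I = "\<lambda>i s. input s \<and> (\<forall>j<i. nmem s 7 j = nmem s0 4 j)"
  have "runs activate_effectors s (13 + ncost node_count + n * (16 + ncost node_count + 10)) (?I n)"
    unfolding activate_effectors_def
  proof (rule runs_For)
    fix i s1
    assume I: "?I i s1" "i < n" "nmem s1 10 0 = i"
    show "runs (NSet 7 (var 10) (NGet 4 (var 10))) s1 10 (?I (Suc i))"
      by (rule runs_weaken[OF runs_loop_free]) (use I in \<open>auto simp: input_simps less_Suc_eq\<close>)
  qed (use assms in \<open>auto simp: input_simps\<close>)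
  then show ?thesis
    by (rule runs_weaken) (use effector_nodes in \<open>auto simp: active_def effector split: if_splits\<close>)
qed

definition live :: "memory \<Rightarrow> (nat \<times> nat) set" where
  "live s = {es ! i | i. i < length es \<and> 0 < nmem s 6 i}"

text \<open>Array \<open>7\<close> is updated in place, so one scan may follow several live arcs in
  a row, depending on their order. The outcome is therefore only bracketed: at least one step of
  \<open>live s\<close>, at most its closure.\<close>

lemma runs_scan_arcs:
  assumes "input s"
  shows "runs scan_arcs s (20 + 50 * length es) (\<lambda>s'. active n s \<union> live s `` active n s \<subseteq> active n s' \<and>
     active n s' \<subseteq> (live s)\<^sup>* `` active n s)"
proof -
  define I where "I i s' \<longleftrightarrow> input s' \<and> nmem s' 6 = nmem s 6 \<and> active n s \<subseteq> active n s' \<and>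
     (\<forall>j<i. 0 < nmem s 6 j \<longrightarrow> fst (es ! j) \<in> active n s \<longrightarrow> snd (es ! j) \<in> active n s') \<and>
     active n s' \<subseteq> (live s)\<^sup>* `` active n s" for i s'
  let ?body = "Cond (BAnd (nonzero (NGet 6 (var 10))) (nonzero (NGet 7 (NGet 1 (var 10)))))
         (NSet 7 (NGet 2 (var 10)) (NConst 1)) Skip"
  have "runs scan_arcs s (13 + ncost arc_count + length es * (16 + ncost arc_count + 30))
     (I (length es))"
    unfolding scan_arcs_def
  proof (rule runs_For)
    fix i s1
    assume I: "I i s1" and i: "i < length es" "nmem s1 10 0 = i"
    have nodes: "fst (es ! i) < n" "snd (es ! i) < n" using arc_nodes i by auto
    let ?fire = "0 < nmem s 6 i \<and> fst (es ! i) \<in> active n s1"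
    have eff: "effect ?body s1 = (if ?fire then nupdate 7 (snd (es ! i)) 1 s1 else s1)"
      using I i nodes by (auto simp: I_def input_simps active_def)
    have act: "active n (effect ?body s1) =
        (if ?fire then insert (snd (es ! i)) (active n s1) else active n s1)"
      using nodes unfolding eff by (auto simp: active_def)
    have "snd (es ! i) \<in> (live s)\<^sup>* `` active n s" if ?fire
    proof -
      have "(fst (es ! i), snd (es ! i)) \<in> live s" using that i by (auto simp: live_def)
      moreover have "fst (es ! i) \<in> (live s)\<^sup>* `` active n s" using that I by (auto simp: I_def)
      ultimately show ?thesis by (blast intro: rtrancl_into_rtrancl)
    qed
    then have "I (Suc i) (effect ?body s1)"
      using I unfolding I_def act by (auto simp: eff less_Suc_eq)
    then show "runs ?body s1 30 (I (Suc i))"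
      by (intro runs_weaken[OF runs_loop_free]) auto
  qed (use assms in \<open>auto simp: I_def input_simps active_def\<close>)
  then show ?thesis
  proof (rule runs_weaken)
    fix s' assume I: "I (length es) s'"
    have "y \<in> active n s'" if "(x, y) \<in> live s" "x \<in> active n s" for x y
    proof -
      obtain j where j: "j < length es" "0 < nmem s 6 j" "(x, y) = es ! j"
        using \<open>(x, y) \<in> live s\<close> unfolding live_def by blast
      then have "fst (es ! j) = x" "snd (es ! j) = y" by (simp_all flip: j(3))
      with j show ?thesis using I \<open>x \<in> active n s\<close> unfolding I_def by blast
    qed
    then show "active n s \<union> live s `` active n s \<subseteq> active n s' \<and>
       active n s' \<subseteq> (live s)\<^sup>* `` active n s"
      using I by (auto simp: I_def)
  qed simp
qed

text \<open>A round that does not reach closure adds a node, so \<open>n\<close> rounds suffice.\<close>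

lemma runs_close_active:
  assumes "input s" "active n s = X"
  shows "runs close_active s (20 + n * (40 + 50 * length es))
    (\<lambda>s'. active n s' = (live s)\<^sup>* `` X)"
proof -
  let ?R = "(live s)\<^sup>* `` X"
  define I where "I i s' \<longleftrightarrow> input s' \<and> nmem s' 6 = nmem s 6 \<and> X \<subseteq> active n s' \<and>
     active n s' \<subseteq> ?R \<and> (i \<le> card (active n s') \<or> active n s' = ?R)" for i s'
  have fin: "finite (active n s')" for s' by (simp add: active_def)
  have closed: "?R \<subseteq> S" if "X \<subseteq> S" "live s `` S \<subseteq> S" for S
    using that Image_closed_trancl[of "live s" S] by blast
  have "runs close_active s (13 + ncost node_count + n * (16 + ncost node_count + (20 + 50 * length es)))
     (I n)"
    unfolding close_active_def
  proof (rule runs_For)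
    fix i s1
    assume I: "I i s1" and i: "i < n" "nmem s1 11 0 = i"
    have live: "live s1 = live s" using I by (simp add: I_def live_def)
    have "input s1" using I by (simp add: I_def)
    note scan = runs_input_frame[OF runs_scan_arcs[OF this] this, unfolded live]
    show "runs scan_arcs s1 (20 + 50 * length es) (I (Suc i))"
    proof (rule runs_weaken[OF scan])
      fix s2
      assume s2: "(active n s1 \<union> live s `` active n s1 \<subseteq> active n s2 \<and>
          active n s2 \<subseteq> (live s)\<^sup>* `` active n s1) \<and> input s2 \<and>
          (\<forall>a. a \<notin> nwrites scan_arcs \<longrightarrow> nmem s2 a = nmem s1 a) \<and>
          (\<forall>a. a \<notin> qwrites scan_arcs \<longrightarrow> qmem s2 a = qmem s1 a)"
      have R: "active n s2 \<subseteq> ?R"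
      proof -
        have "active n s2 \<subseteq> (live s)\<^sup>* `` active n s1" "active n s1 \<subseteq> ?R"
          using s2 I by (auto simp: I_def)
        then show ?thesis by (blast intro: rtrancl_trans)
      qed
      moreover have "Suc i \<le> card (active n s2) \<or> active n s2 = ?R"
      proof (cases "active n s2 = active n s1")
        case True
        \<comment> \<open>A scan that changes nothing shows the active set to be closed under live
          arcs; as it contains \<open>X\<close>, it contains all reachable nodes.\<close>
        then have "?R \<subseteq> active n s2" using s2 I by (intro closed) (auto simp: I_def)
        then show ?thesis using R by auto
      next
        case False
        then have "active n s1 \<subset> active n s2" using s2 by auto
        then have "card (active n s1) < card (active n s2)" using fin by (rule psubset_card_mono[rotated])
        moreover have "i \<le> card (active n s1) \<or> active n s1 = ?R" using I by (simp add: I_def)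
        ultimately show ?thesis using R s2 by auto
      qed
      ultimately show "I (Suc i) s2" using s2 I by (auto simp: I_def)
    qed simp_all
  qed (use assms in \<open>auto simp: I_def input_simps active_def\<close>)
  then show ?thesis
  proof (rule runs_weaken)
    fix s' assume I: "I n s'"
    have sub: "active n s' \<subseteq> {..<n}" by (auto simp: active_def)
    have "live s \<subseteq> set es" by (auto simp: live_def)
    then have "?R \<subseteq> {..<n}"
      using effector_nodes arc_nodes by (intro closed) fastforce+
    \<comment> \<open>With \<open>n\<close> active nodes the active set is all of
      \<open>{..<n}\<close>, and \<open>?R\<close> lies between the two.\<close>
    moreover have "active n s' = {..<n}" if "n \<le> card (active n s')"
      using sub that by (intro card_seteq) auto
    ultimately show "active n s' = ?R" using I by (auto simp: I_def)
  qed (simp add: algebra_simps)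
qed

text \<open>Here \<open>K\<close> is the number of worlds processed so far, which makes this partial
  sum the invariant of the outer loop.\<close>

definition total_score :: "(nat set \<Rightarrow> rat) \<Rightarrow> nat \<Rightarrow> rat" where
  "total_score val K = (\<Sum>k<K. world_prob w (rev es) k * val (reach (set es) X (world w (rev es) k)))"

lemma live_eq_reach:
  assumes "\<forall>i<length es. 0 < nmem s 6 i \<longleftrightarrow> F (es ! i)"
  shows "(live s)\<^sup>* `` X = reach (set es) X F"
proof -
  have "live s = {(u, v) \<in> set es. F (u, v)}"
    using assms by (force simp: live_def in_set_conv_nth)
  then show ?thesis by (simp add: reach_def)
qed

context
  fixes score :: com and val :: "nat set \<Rightarrow> rat" and D :: nat
  assumes score: "\<And>s. input s \<Longrightarrow> runs score s (D * (n + 1)) (\<lambda>s'. qmem s' 3 0 = val (active n s))"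
    and score_writes: "nwrites score \<subseteq> {10}" "qwrites score \<subseteq> {3}"
begin

lemma runs_process_world:
  assumes "input s" "tabulated s" "nmem s 8 0 = k" "qmem s 1 0 = total_score val k"
  shows "runs (process_world score) s
    (120 + 100 * length es + 80 * n + 50 * (n * length es) + D * (n + 1))
    (\<lambda>s'. qmem s' 1 0 = total_score val (Suc k))"
proof -
  let ?F = "world w (rev es) k" and ?p = "world_prob w (rev es) k"
  let ?R = "reach (set es) X ?F"
  let ?add = "QSet 1 (NConst 0) (QPlus (QGet 1 (NConst 0)) (QTimes (QGet 2 (NConst 0)) (QGet 3 (NConst 0))))"
  let ?J = "\<lambda>s'. input s' \<and> qmem s' 1 0 = total_score val k \<and> qmem s' 2 0 = ?p"
  have "runs (process_world score) s (1 + (40 + 100 * length es) + (1 + (20 + 40 * n) +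
      (1 + (20 + n * (40 + 50 * length es)) + (1 + D * (n + 1) + 10))))
      (\<lambda>s'. qmem s' 1 0 = total_score val (Suc k))"
    unfolding process_world_def
  proof (intro runs_Seq)
    \<comment> \<open>The target set \<open>?R\<close> is tied to array \<open>6\<close> before any
      node is activated; the equation is carried along, since activation does not write array
      \<open>6\<close>, until \<open>close_active\<close> uses it.\<close>
    show "runs decode_world s (40 + 100 * length es)
        (\<lambda>s'. ?J s' \<and> (live s')\<^sup>* `` X = ?R)"
      by (rule runs_weaken[OF runs_input_frame[OF runs_decode_world[OF assms(1,2)] assms(1)]])
        (use assms in \<open>auto intro!: live_eq_reach\<close>)
    show "runs activate_effectors s1 (20 + 40 * n)
        (\<lambda>s'. ?J s' \<and> (live s')\<^sup>* `` X = ?R \<and> active n s' = X)"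
      if s1: "?J s1 \<and> (live s1)\<^sup>* `` X = ?R" for s1
    proof -
      have "input s1" using s1 by blast
      from runs_input_frame[OF runs_activate_effectors[OF this] this] show ?thesis
        by (rule runs_weaken) (use s1 in \<open>auto simp: live_def\<close>)
    qed
    show "runs close_active s1 (20 + n * (40 + 50 * length es)) (\<lambda>s'. ?J s' \<and> active n s' = ?R)"
      if s1: "?J s1 \<and> (live s1)\<^sup>* `` X = ?R \<and> active n s1 = X" for s1
    proof -
      have "input s1" "active n s1 = X" using s1 by blast+
      from runs_input_frame[OF runs_close_active[OF this] this(1)] show ?thesis
        by (rule runs_weaken) (use s1 in auto)
    qed
    show "runs score s1 (D * (n + 1)) (\<lambda>s'. ?J s' \<and> qmem s' 3 0 = val ?R)"
      if s1: "?J s1 \<and> active n s1 = ?R" for s1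
    proof -
      have "input s1" using s1 by blast
      have q: "1 \<notin> qwrites score" "2 \<notin> qwrites score" "0 \<notin> qwrites score"
        "\<forall>a\<in>nwrites score. 5 \<le> a" using score_writes by auto
      from runs_input_frame[OF score[OF \<open>input s1\<close>] \<open>input s1\<close> q(4,3)] show ?thesis
        by (rule runs_weaken) (use s1 q in auto)
    qed
    show "runs ?add s1 10 (\<lambda>s'. qmem s' 1 0 = total_score val (Suc k))"
      if "?J s1 \<and> qmem s1 3 0 = val ?R" for s1
      by (rule runs_weaken[OF runs_loop_free]) (use that in \<open>auto simp: total_score_def\<close>)
  qed
  then show ?thesis by (rule runs_weaken) (auto simp: algebra_simps)
qed

text \<open>The loop bound is a mere lookup in the table; \<open>139\<close> is the
  \<open>120\<close> of a single world plus the loop overhead \<open>16 + 3\<close>, the lookup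
  costing \<open>3\<close>.\<close>

lemma runs_average_worlds:
  "runs (average_worlds score) s0
    (60 + 50 * length es + worlds w (rev es) *
      (139 + 100 * length es + 80 * n + 50 * (n * length es) + D * (n + 1)))
    (\<lambda>s'. result s' = total_score val (worlds w (rev es)))"
proof -
  let ?m = "length es" and ?W = "worlds w (rev es)"
  let ?t = "120 + 100 * ?m + 80 * n + 50 * (n * ?m) + D * (n + 1)"
  let ?I = "\<lambda>k s. input s \<and> tabulated s \<and> qmem s 1 0 = total_score val k"
  let ?b = "NGet 5 arc_count"
  have "input s0" by (simp add: input_def)
  have "runs (average_worlds score) s0
      (1 + (30 + 50 * ?m) + (1 + 3 + (13 + ncost ?b + ?W * (16 + ncost ?b + ?t)))) (?I ?W)"
    unfolding average_worlds_def
  proof (intro runs_Seq)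
    show "runs tabulate_worlds s0 (30 + 50 * ?m) (\<lambda>s'. input s' \<and> tabulated s')"
      by (rule runs_weaken[OF runs_input_frame[OF runs_tabulate_worlds[OF \<open>input s0\<close>] \<open>input s0\<close>]]) auto
    show "runs (QSet 1 (NConst 0) (QConst 0)) s1 3 (?I 0)" if "input s1 \<and> tabulated s1" for s1
      by (rule runs_weaken[OF runs_loop_free])
        (use that in \<open>auto simp: total_score_def tabulated_def\<close>)
    show "runs (For 8 ?b (process_world score)) s1 (13 + ncost ?b + ?W * (16 + ncost ?b + ?t)) (?I ?W)"
      if "?I 0 s1" for s1
    proof (rule runs_For)
      show "8 \<notin> nwrites (process_world score)" using score_writes by auto
      show "?I 0 s1" by (rule that)
      show "nval ?b s2 = ?W" if "?I k s2" for k s2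
        using that by (simp add: tabulated_def input_simps)
      show "?I k (nupdate 8 0 j s2)" if "?I k s2" for k j s2
        using that by (simp add: tabulated_def)
      fix k s2
      assume I: "?I k s2" "nmem s2 8 0 = k"
      have writes: "5 \<notin> nwrites (process_world score)"
        "\<forall>a\<in>nwrites (process_world score). 5 \<le> a" "0 \<notin> qwrites (process_world score)"
        using score_writes by auto
      have "input s2" "tabulated s2" "qmem s2 1 0 = total_score val k" using I by blast+
      note process = runs_input_frame[OF runs_process_world[OF this(1,2) I(2) this(3)] this(1) writes(2,3)]
      show "runs (process_world score) s2 ?t (?I (Suc k))"
        by (rule runs_weaken[OF process order_refl]) (use writes(1) I in \<open>simp add: tabulated_def\<close>)
    qed
  qed
  then show ?thesis by (rule runs_weaken) (auto simp: result_def algebra_simps)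
qed

end

text \<open>The lookup takes constant time; the factor \<open>n + 1\<close> gives the bound the
  shape \<open>D * (n + 1)\<close> expected of a score.\<close>

lemma runs_query_score:
  assumes "input s" "nmem s0 0 2 = v" "v < n"
  shows "runs query_score s (15 * (n + 1)) (\<lambda>s'. qmem s' 3 0 = of_bool (v \<in> active n s))"
  by (rule runs_weaken[OF runs_loop_free])
    (use assms in \<open>auto simp: query_score_def input_simps active_def\<close>)

lemma runs_cost_score:
  assumes "input s" "\<And>i. nmem s0 3 i = (if i \<in> A then 1 else 0)" "A \<subseteq> {..<n}"
  shows "runs cost_score s (70 * (n + 1))
    (\<lambda>s'. qmem s' 3 0 = (\<Sum>v\<in>A. of_bool (v \<notin> active n s)) + (\<Sum>v\<in>{..<n} - A. of_bool (v \<in> active n s)))"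
proof -
  let ?wrong = "\<lambda>v. of_bool (v \<in> A \<longleftrightarrow> v \<notin> active n s) :: rat"
  let ?I = "\<lambda>i s'. input s' \<and> nmem s' 7 = nmem s 7 \<and> qmem s' 3 0 = (\<Sum>v<i. ?wrong v)"
  let ?body = "Cond (BAnd (BNot (BAnd (nonzero (NGet 3 (var 10))) (nonzero (NGet 7 (var 10)))))
                     (BNot (BAnd (BNot (nonzero (NGet 3 (var 10)))) (BNot (nonzero (NGet 7 (var 10)))))))
           (QSet 3 (NConst 0) (QPlus (QGet 3 (NConst 0)) (QConst 1)))
           Skip"
  have "runs cost_score s (1 + 3 + (13 + ncost node_count + n * (16 + ncost node_count + 50))) (?I n)"
    unfolding cost_score_def
  proof (rule runs_Seq)
    show "runs (QSet 3 (NConst 0) (QConst 0)) s 3 (?I 0)"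
      by (rule runs_weaken[OF runs_loop_free]) (use assms in auto)
    show "runs (For 10 node_count ?body) s1 (13 + ncost node_count + n * (16 + ncost node_count + 50)) (?I n)"
      if "?I 0 s1" for s1
    proof (rule runs_For[where I = ?I])
      fix i s2
      assume I: "?I i s2" "i < n" "nmem s2 10 0 = i"
      show "runs ?body s2 50 (?I (Suc i))"
        by (rule runs_weaken[OF runs_loop_free])
          (use I assms(2) in \<open>auto simp: input_simps active_def\<close>)
    qed (use that in \<open>auto simp: input_simps\<close>)
  qed
  then show ?thesis
  proof (rule runs_weaken)
    fix s' assume "?I n s'"
    then have "qmem s' 3 0 = (\<Sum>v<n. ?wrong v)" by blast
    also have "\<dots> = (\<Sum>v\<in>A. ?wrong v) + (\<Sum>v\<in>{..<n} - A. ?wrong v)"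
      using sum.subset_diff[OF assms(3), of ?wrong] by (simp add: add.commute)
    also have "(\<Sum>v\<in>A. ?wrong v) = (\<Sum>v\<in>A. of_bool (v \<notin> active n s))"
      by (rule sum.cong) auto
    also have "(\<Sum>v\<in>{..<n} - A. ?wrong v) = (\<Sum>v\<in>{..<n} - A. of_bool (v \<in> active n s))"
      by (rule sum.cong) auto
    finally show "qmem s' 3 0 =
      (\<Sum>v\<in>A. of_bool (v \<notin> active n s)) + (\<Sum>v\<in>{..<n} - A. of_bool (v \<in> active n s))" .
  qed simp
qed

end

section \<open>From machine runs to the bounds in terms of the graph\<close>

lemma network_memory_instance:
  assumes "effectors_instance G w es A X" "s0 = encode_instance G w es A X \<or> s0 = encode_query G w es A X v"
  shows "network_memory s0 (card (pverts G)) es w X"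
proof -
  interpret influence_graph G w using assms(1) by (simp add: effectors_instance_def)
  show ?thesis
  proof
    fix e assume "e \<in> set es"
    then have "e \<in> parcs G" using assms(1) by (simp add: effectors_instance_def)
    moreover have "pverts G = {..<card (pverts G)}" using assms(1) by (simp add: effectors_instance_def)
    ultimately show "fst e < card (pverts G) \<and> snd e < card (pverts G)"
      using tail_in_verts head_in_verts by fastforce
  qed (use assms in \<open>auto simp: effectors_instance_def encode_query_def encode_instance_def\<close>)
qed

text \<open>Weights are at most \<open>1\<close>, so the arcs that double the count, those with
  \<open>w e \<noteq> 1\<close>, are exactly the probabilistic ones.\<close>

lemma worlds_probabilistic_arcs:
  assumes "influence_graph G w" "distinct es" "set es = parcs G"
  shows "worlds w (rev es) = 2 ^ card (probabilistic_arcs G w)"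
proof -
  have "probabilistic_arcs G w = set (filter (\<lambda>e. w e \<noteq> 1) (rev es))"
    using influence_graph.weight_le_1[OF assms(1)] assms(3)
    by (force simp: probabilistic_arcs_def)
  moreover have "distinct (filter (\<lambda>e. w e \<noteq> 1) (rev es))" using assms(2) by simp
  ultimately show ?thesis by (metis worlds_eq_power distinct_card)
qed

text \<open>For \<open>n > 0\<close> each of \<open>1\<close>, \<open>m\<close>, \<open>n\<close>
  and \<open>n * m\<close> is at most \<open>n * (n + m)\<close>, and \<open>W > 0\<close> absorbs
  the set-up time into the loop. The coefficients \<open>199 + 150 + 80 + 50\<close> stay below
  \<open>500\<close>, and \<open>n + 1\<close> is at most \<open>2 * (n * (n + m))\<close>, whence
  \<open>2 * D\<close>.\<close>

lemma time_bound:
  fixes n m W D c :: nat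
  assumes "0 < n" "0 < W" "c = 500 + 2 * D"
  shows "60 + 50 * m + W * (139 + 100 * m + 80 * n + 50 * (n * m) + D * (n + 1))
    \<le> c * (W * (n * (n + m)))"
proof -
  have n: "1 \<le> n * (n + m)" "m \<le> n * (n + m)" "n \<le> n * (n + m)" "n * m \<le> n * (n + m)"
    using assms(1) by (auto simp: Suc_le_eq algebra_simps intro: trans_le_add2 trans_le_add1)
  have "60 + 50 * m \<le> W * (60 + 50 * m)" using assms(2) by simp
  then have "60 + 50 * m + W * (139 + 100 * m + 80 * n + 50 * (n * m) + D * (n + 1))
      \<le> W * (199 + 150 * m + 80 * n + 50 * (n * m) + D * (n + 1))"
    by (simp add: algebra_simps)
  also have "n + 1 \<le> 2 * (n * (n + m))" using n by linarith
  then have "D * (n + 1) \<le> D * (2 * (n * (n + m)))" by (rule mult_left_mono) simp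
  then have "W * (199 + 150 * m + 80 * n + 50 * (n * m) + D * (n + 1))
      \<le> W * (500 * (n * (n + m)) + D * (2 * (n * (n + m))))"
    using n by (intro mult_left_mono) linarith+
  also have "\<dots> = c * (W * (n * (n + m)))" by (simp add: assms(3) algebra_simps)
  finally show ?thesis .
qed

lemma average_worlds_query:
  assumes inst: "effectors_instance G w es A X" and v: "v \<in> pverts G"
  shows "\<exists>t s. exec (average_worlds query_score) (encode_query G w es A X v) t s \<and>
    real_of_rat (result s) = activation_prob G w X v \<and>
    t \<le> 530 * (2 ^ card (probabilistic_arcs G w) * (card (pverts G) * (card (pverts G) + card (parcs G))))"
proof -
  let ?n = "card (pverts G)" and ?r = "card (probabilistic_arcs G w)"
  interpret influence_graph G w using inst by (simp add: effectors_instance_def)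
  interpret network_memory "encode_query G w es A X v" ?n es w X
    using inst by (intro network_memory_instance) auto
  have es: "set es = parcs G" "length es = card (parcs G)"
    using inst distinct_card[of es] by (auto simp: effectors_instance_def)
  have W: "worlds w (rev es) = 2 ^ ?r"
    by (intro worlds_probabilistic_arcs distinct_arcs es influence_graph_axioms)
  have v: "v < ?n" using inst v by (auto simp: effectors_instance_def)
  define val :: "nat set \<Rightarrow> rat" where "val S = of_bool (v \<in> S)" for S
  have "nmem (encode_query G w es A X v) 0 2 = v" by (simp add: encode_query_def)
  then have score: "runs query_score s (15 * (?n + 1)) (\<lambda>s'. qmem s' 3 0 = val (active ?n s))" if "input s" for s
    unfolding val_def by (rule runs_query_score[OF that _ v])
  have "runs (average_worlds query_score) (encode_query G w es A X v)
      (60 + 50 * length es + worlds w (rev es) *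
        (139 + 100 * length es + 80 * ?n + 50 * (?n * length es) + 15 * (?n + 1)))
      (\<lambda>s'. result s' = total_score val (worlds w (rev es)))"
    by (rule runs_average_worlds[OF score]) auto
  then obtain t s where ts: "exec (average_worlds query_score) (encode_query G w es A X v) t s"
    "result s = total_score val (2 ^ ?r)"
    "t \<le> 60 + 50 * length es + 2 ^ ?r * (139 + 100 * length es + 80 * ?n + 50 * (?n * length es)
      + 15 * (?n + 1))"
    unfolding runs_def W by blast
  \<comment> \<open>The list \<open>rev es\<close> has the same arcs as \<open>es\<close>, with the
    most significant digit first.\<close>
  have result: "real_of_rat (total_score val (2 ^ ?r)) = activation_prob G w X v"
    using W es distinct_arcs
    by (simp add: activation_prob_worlds[of "rev es"] total_score_def val_def of_rat_sum of_rat_mult)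
  \<comment> \<open>The queried node itself witnesses that the graph is nonempty.\<close>
  have time: "60 + 50 * length es + 2 ^ ?r * (139 + 100 * length es + 80 * ?n + 50 * (?n * length es)
      + 15 * (?n + 1)) \<le> 530 * (2 ^ ?r * (?n * (?n + card (parcs G))))"
    unfolding es(2) using v by (intro time_bound) auto
  show ?thesis
  proof (intro exI conjI)
    show "exec (average_worlds query_score) (encode_query G w es A X v) t s" by (rule ts)
    show "real_of_rat (result s) = activation_prob G w X v" unfolding ts(2) by (rule result)
    show "t \<le> 530 * (2 ^ ?r * (?n * (?n + card (parcs G))))"
      using order_trans[OF ts(3) time] .
  qed
qed

lemma of_rat_of_bool: "of_rat (of_bool b) = of_bool b"
  by simp

text \<open>On the empty graph the bound would be \<open>0\<close>, whereas every run takes time;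
  hence the time claim is guarded, while the result is correct in all cases.\<close>

lemma average_worlds_cost:
  assumes inst: "effectors_instance G w es A X"
  shows "\<exists>t s. exec (average_worlds cost_score) (encode_instance G w es A X) t s \<and>
    real_of_rat (result s) = effectors_cost G w A X \<and>
    (card (pverts G) \<ge> 1 \<longrightarrow> t \<le> 640 *
      (2 ^ card (probabilistic_arcs G w) * (card (pverts G) * (card (pverts G) + card (parcs G)))))"
proof -
  let ?n = "card (pverts G)" and ?r = "card (probabilistic_arcs G w)"
  interpret influence_graph G w using inst by (simp add: effectors_instance_def)
  interpret network_memory "encode_instance G w es A X" ?n es w X
    using inst by (intro network_memory_instance) auto
  have es: "set es = parcs G" "length es = card (parcs G)"
    using inst distinct_card[of es] by (auto simp: effectors_instance_def)
  have W: "worlds w (rev es) = 2 ^ ?r"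
    by (intro worlds_probabilistic_arcs distinct_arcs es influence_graph_axioms)
  have V: "pverts G = {..<?n}" "A \<subseteq> {..<?n}" using inst by (auto simp: effectors_instance_def)
  define val :: "nat set \<Rightarrow> rat" where
    "val S = (\<Sum>v\<in>A. of_bool (v \<notin> S)) + (\<Sum>v\<in>pverts G - A. of_bool (v \<in> S))" for S
  have "nmem (encode_instance G w es A X) 3 i = (if i \<in> A then 1 else 0)" for i
    by (simp add: encode_instance_def)
  note score = runs_cost_score[OF _ this V(2), folded V(1), folded val_def]
  have "runs (average_worlds cost_score) (encode_instance G w es A X)
      (60 + 50 * length es + worlds w (rev es) *
        (139 + 100 * length es + 80 * ?n + 50 * (?n * length es) + 70 * (?n + 1)))
      (\<lambda>s'. result s' = total_score val (worlds w (rev es)))"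
    by (rule runs_average_worlds[OF score]) auto
  then obtain t s where ts: "exec (average_worlds cost_score) (encode_instance G w es A X) t s"
    "result s = total_score val (2 ^ ?r)"
    "t \<le> 60 + 50 * length es + 2 ^ ?r * (139 + 100 * length es + 80 * ?n + 50 * (?n * length es)
      + 70 * (?n + 1))"
    unfolding runs_def W by blast
  have result: "real_of_rat (total_score val (2 ^ ?r)) = effectors_cost G w A X"
    using effectors_cost_worlds[of "rev es" A X] W es distinct_arcs
    by (simp add: total_score_def val_def of_rat_sum of_rat_mult of_rat_add of_rat_of_bool)
  have time: "60 + 50 * length es + 2 ^ ?r * (139 + 100 * length es + 80 * ?n + 50 * (?n * length es)
      + 70 * (?n + 1)) \<le> 640 * (2 ^ ?r * (?n * (?n + card (parcs G))))" if "1 \<le> ?n"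
    unfolding es(2) using that by (intro time_bound) auto
  show ?thesis
  proof (intro exI conjI impI)
    show "exec (average_worlds cost_score) (encode_instance G w es A X) t s" by (rule ts)
    show "real_of_rat (result s) = effectors_cost G w A X" unfolding ts(2) by (rule result)
    show "t \<le> 640 * (2 ^ ?r * (?n * (?n + card (parcs G))))" if "1 \<le> ?n"
      using order_trans[OF ts(3) time[OF that]] .
  qed
qed

theorem theorem2:
  shows "(\<exists>(P :: com) (c :: nat). \<forall>G w es A X v.
      effectors_instance G w es A X \<longrightarrow> v \<in> pverts G \<longrightarrow>
      (let n = card (pverts G); m = card (parcs G); r = card (probabilistic_arcs G w) in
        \<exists>t s. exec P (encode_query G w es A X v) t s \<and>
          real_of_rat (result s) = activation_prob G w X v \<and>
          t \<le> c * (2 ^ r * (n * (n + m)))))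
    \<and> (\<exists>(Q :: com) (c :: nat). \<forall>G w es A X.
      effectors_instance G w es A X \<longrightarrow>
      (let n = card (pverts G); m = card (parcs G); r = card (probabilistic_arcs G w) in
        \<exists>t s. exec Q (encode_instance G w es A X) t s \<and>
          real_of_rat (result s) = effectors_cost G w A X \<and>
          (n \<ge> 1 \<longrightarrow> t \<le> c * (2 ^ r * (n ^ 2 * (n + m))))))"
proof (rule conjI, goal_cases)
  case 1
  show ?case
    by (rule exI[of _ "average_worlds query_score"], rule exI[of _ 530])
      (simp add: Let_def average_worlds_query)
next
  case 2
  \<comment> \<open>One pass scores all nodes, so \<open>n * (n + m)\<close> per world is already
    achieved; the required bound follows from \<open>n \<le> n ^ 2\<close>.\<close>
  have "n * (n + m) \<le> n ^ 2 * (n + m)" for n m :: nat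
    by (simp add: power2_eq_square)
  then have le: "640 * (2 ^ r * (n * (n + m))) \<le> 640 * (2 ^ r * (n ^ 2 * (n + m)))" for r n m :: nat
    by simp
  show ?case
    unfolding Let_def
  proof (rule exI[of _ "average_worlds cost_score"], rule exI[of _ 640], intro allI impI)
    fix G w es A X
    assume "effectors_instance G w es A X"
    from average_worlds_cost[OF this] obtain t s where
      "exec (average_worlds cost_score) (encode_instance G w es A X) t s"
      "real_of_rat (result s) = effectors_cost G w A X"
      "1 \<le> card (pverts G) \<longrightarrow> t \<le> 640 *
        (2 ^ card (probabilistic_arcs G w) * (card (pverts G) * (card (pverts G) + card (parcs G))))"
      by blast
    then show "\<exists>t s. exec (average_worlds cost_score) (encode_instance G w es A X) t s \<and>
      real_of_rat (result s) = effectors_cost G w A X \<and>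
      (1 \<le> card (pverts G) \<longrightarrow> t \<le> 640 *
        (2 ^ card (probabilistic_arcs G w) * (card (pverts G) ^ 2 * (card (pverts G) + card (parcs G)))))"
      using order_trans[OF _ le] by (intro exI[of _ t] exI[of _ s]) simp
  qed
qed

end
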